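(* Let $\mathbb{F}$ be a field and $E=\mathbb{F}^n$, with a fixed nondegenerate bilinear form. (1) If $\mathcal{B}$ is the family of bases of a $q$-matroid with ground space $E$, then $(E,\mathcal{B})$ is a $q$-$g$-matroid. (2) If $\mathcal{I}$ is the family of independent spaces of a $q$-matroid with ground space $E$, then $(E,\mathcal{I})$ is a $q$-$g$-matroid. (3) If $\mathcal{S}$ is the family of spanning spaces of a $q$-matroid with ground space $E$, then $(E,\mathcal{S})$ is a $q$-$g$-matroid. (4) Let $(E,\mathcal{F})$ be a $q$-$g$-matroid. Let $\mathcal{F}_U$ (resp. $\mathcal{F}_L$) be the set of those elements of $\mathcal{F}$ that have the maximum (resp. minimum) dimension among the elements of $\mathcal{F}$. Then $\mathcal{F}_U$ and $\mathcal{F}_L$ are each the family of bases of a $q$-matroid on $E$. (5) If $(E,\mathcal{F})$ is a $q$-$g$-matroid, then $(E,\mathcal{F}^\perp)$, where $\mathcal{F}^\perp=\{F^\perp:F\in\mathcal{F}\}$, is a $q$-$g$-matroid as well.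
   Context: $E=\mathbb{F}^n$ is a finite-dimensional vector space over a field $\mathbb{F}$; $W^\perp$ is the orthogonal complement of $W\subseteq E$ with respect to the fixed nondegenerate bilinear form. A $q$-matroid on $E$ is a pair $M=(E,r)$ with $r$ an integer-valued function on the subspaces of $E$ such that (R1) $0\le r(A)\le\dim A$ for every subspace $A$; (R2) $r(A)\le r(B)$ whenever $A\subseteq B$; (R3) $r(A+B)+r(A\cap B)\le r(A)+r(B)$ for all subspaces $A,B$. A subspace $A$ is independent if $r(A)=\dim A$; a basis is an inclusion-maximal independent subspace; $A$ is spanning if $r(A)=r(E)$; $A$ is a flat if $r(A+x)>r(A)$ for every $1$-dimensional subspace $x\not\subseteq A$. For $q$-matroids $M_1,M_2$ on the same ground space $E$, the identity $Id:M_1\to M_2$ is a strong map if every flat of $M_2$ is a flat of $M_1$. A $q$-$g$-matroid is a pair $(E,\mathcal{F})$ for which there exist $q$-matroids $M_1,M_2$ on $E$ such that $Id:M_1\to M_2$ is a strong map and $\mathcal{F}$ is the set of all subspaces of $E$ that are independent in $M_1$ and spanning in $M_2$. *)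

theory Defs
  imports Complex_Main
begin

(* The ground space E is the whole type 'b, with scalar multiplication scale over the field 'a;
   it is made finite-dimensional where it is used, by assuming finite_dimensional_vector_space.
   Coordinates play no role, so F^n is covered for every n, including n = 0.
   Only the values of r on subspaces are ever constrained or used. *)

locale q_matroid = vector_space scale
  for scale :: "'a::field \<Rightarrow> 'b::ab_group_add \<Rightarrow> 'b" +
  fixes r :: "'b set \<Rightarrow> int"
  assumes rank_bounds: "subspace A \<Longrightarrow> 0 \<le> r A \<and> r A \<le> int (dim A)"
    and rank_mono: "subspace A \<Longrightarrow> subspace B \<Longrightarrow> A \<subseteq> B \<Longrightarrow> r A \<le> r B"
    and rank_submodular: "subspace A \<Longrightarrow> subspace B \<Longrightarrow>
      r {x + y |x y. x \<in> A \<and> y \<in> B} + r (A \<inter> B) \<le> r A + r B"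
begin

definition indep_space :: "'b set \<Rightarrow> bool" where
  "indep_space A \<longleftrightarrow> subspace A \<and> r A = int (dim A)"

definition basis_space :: "'b set \<Rightarrow> bool" where
  "basis_space A \<longleftrightarrow> indep_space A \<and> (\<forall>B. indep_space B \<and> A \<subseteq> B \<longrightarrow> B = A)"

definition spanning_space :: "'b set \<Rightarrow> bool" where
  "spanning_space A \<longleftrightarrow> subspace A \<and> r A = r UNIV"

definition flat :: "'b set \<Rightarrow> bool" where
  "flat A \<longleftrightarrow> subspace A \<and>
    (\<forall>L. subspace L \<and> dim L = 1 \<and> \<not> L \<subseteq> A \<longrightarrow> r {x + y |x y. x \<in> A \<and> y \<in> L} > r A)"

end

definition id_strong_map ::
  "('a::field \<Rightarrow> 'b::ab_group_add \<Rightarrow> 'b) \<Rightarrow> ('b set \<Rightarrow> int) \<Rightarrow> ('b set \<Rightarrow> int) \<Rightarrow> bool" where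
  "id_strong_map scale r1 r2 \<longleftrightarrow>
    (\<forall>A. q_matroid.flat scale r2 A \<longrightarrow> q_matroid.flat scale r1 A)"

definition q_g_matroid ::
  "('a::field \<Rightarrow> 'b::ab_group_add \<Rightarrow> 'b) \<Rightarrow> 'b set set \<Rightarrow> bool" where
  "q_g_matroid scale \<F> \<longleftrightarrow>
    (\<exists>r1 r2. q_matroid scale r1 \<and> q_matroid scale r2 \<and> id_strong_map scale r1 r2 \<and>
      \<F> = {A. q_matroid.indep_space scale r1 A \<and> q_matroid.spanning_space scale r2 A})"

definition bases_of_q_matroid ::
  "('a::field \<Rightarrow> 'b::ab_group_add \<Rightarrow> 'b) \<Rightarrow> 'b set set \<Rightarrow> bool" where
  "bases_of_q_matroid scale \<B> \<longleftrightarrow>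
    (\<exists>r. q_matroid scale r \<and> \<B> = {A. q_matroid.basis_space scale r A})"

definition indeps_of_q_matroid ::
  "('a::field \<Rightarrow> 'b::ab_group_add \<Rightarrow> 'b) \<Rightarrow> 'b set set \<Rightarrow> bool" where
  "indeps_of_q_matroid scale \<I> \<longleftrightarrow>
    (\<exists>r. q_matroid scale r \<and> \<I> = {A. q_matroid.indep_space scale r A})"

definition spannings_of_q_matroid ::
  "('a::field \<Rightarrow> 'b::ab_group_add \<Rightarrow> 'b) \<Rightarrow> 'b set set \<Rightarrow> bool" where
  "spannings_of_q_matroid scale \<S> \<longleftrightarrow>
    (\<exists>r. q_matroid scale r \<and> \<S> = {A. q_matroid.spanning_space scale r A})"

definition max_dim_members ::
  "('a::field \<Rightarrow> 'b::ab_group_add \<Rightarrow> 'b) \<Rightarrow> 'b set set \<Rightarrow> 'b set set" where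
  "max_dim_members scale \<F> =
    {A \<in> \<F>. \<forall>B\<in>\<F>. vector_space.dim scale B \<le> vector_space.dim scale A}"

definition min_dim_members ::
  "('a::field \<Rightarrow> 'b::ab_group_add \<Rightarrow> 'b) \<Rightarrow> 'b set set \<Rightarrow> 'b set set" where
  "min_dim_members scale \<F> =
    {A \<in> \<F>. \<forall>B\<in>\<F>. vector_space.dim scale A \<le> vector_space.dim scale B}"

definition nondegenerate_bilinear_form ::
  "('a::field \<Rightarrow> 'b::ab_group_add \<Rightarrow> 'b) \<Rightarrow> ('b \<Rightarrow> 'b \<Rightarrow> 'a) \<Rightarrow> bool" where
  "nondegenerate_bilinear_form scale \<beta> \<longleftrightarrow>
    (\<forall>x. Vector_Spaces.linear scale (*) (\<beta> x)) \<and>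
    (\<forall>y. Vector_Spaces.linear scale (*) (\<lambda>x. \<beta> x y)) \<and>
    (\<forall>x. (\<forall>y. \<beta> x y = 0) \<longrightarrow> x = 0) \<and>
    (\<forall>y. (\<forall>x. \<beta> x y = 0) \<longrightarrow> y = 0)"

(* The form need not be symmetric; this is the right complement.  Nondegenerate bilinear forms are
   closed under swapping the arguments, so a statement about all of them covers the left one too. *)
definition orth_compl :: "('b \<Rightarrow> 'b \<Rightarrow> 'a::zero) \<Rightarrow> 'b set \<Rightarrow> 'b set" where
  "orth_compl \<beta> W = {v. \<forall>w\<in>W. \<beta> w v = 0}"

end

(* The identity M1 -> M2 is strong iff r2 B - r2 A <= r1 B - r1 A whenever A <= B: if adjoining x
   raises the r2-rank of C, then x lies outside an M2-flat F containing C of the same r2-rank; F is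
   also an M1-flat, and submodularity carries the increase of r1 from F down to C.
   This inequality, unlike the condition on flats, dualizes at once.  It also shows that bases of M1
   are spanning in M2 and bases of M2 are independent in M1, so these are the members of the family of
   maximum and minimum dimension.  The free and the zero q-matroid provide the strong maps for
   spanning and independent spaces. *)

theory Submission
  imports Defs
begin

section \<open>Sums of subspaces and chains of subspaces\<close>

abbreviation subspace_sum :: "'b::plus set \<Rightarrow> 'b set \<Rightarrow> 'b set" where
  "subspace_sum A B \<equiv> {x + y |x y. x \<in> A \<and> y \<in> B}"

context finite_dimensional_vector_space
begin

lemma subset_subspace_sum:
  assumes "subspace A" "subspace B"
  shows "A \<subseteq> subspace_sum A B" "B \<subseteq> subspace_sum A B"
  using subspace_0[OF assms(1)] subspace_0[OF assms(2)] by force+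

lemma subspace_sum_span_singleton:
  assumes "subspace A"
  shows "subspace_sum A (span {x}) = span (insert x A)"
proof -
  have "span (A \<union> {x}) = subspace_sum A (span {x})"
    unfolding span_Un using assms by (simp add: span_eq_iff[THEN iffD2])
  then show ?thesis by simp
qed

lemma dim_span_insert:
  assumes "subspace A" "x \<notin> A"
  shows "dim (span (insert x A)) = Suc (dim A)"
  using assms by (simp add: dim_insert span_eq_iff[THEN iffD2])

lemma subset_span_insert: "A \<subseteq> span (insert x A)"
  using span_superset by blast

lemma dim_le_dim_UNIV: "dim A \<le> dim UNIV"
  by (rule dim_subset) simp

text \<open>Downward induction from \<open>B\<close> to \<open>A\<close>, one dimension at a time,
  on the codimension of \<open>C\<close> in \<open>B\<close>. An inequality between values at
  \<open>A\<close> and at \<open>B\<close> thereby reduces to the increment caused by a single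
  vector.\<close>

lemma subspace_chain_induct [consumes 3, case_names refl insert]:
  assumes "subspace A" "subspace B" "A \<subseteq> B"
    and refl: "P B"
    and step: "\<And>C x. subspace C \<Longrightarrow> A \<subseteq> C \<Longrightarrow> C \<subseteq> B \<Longrightarrow> x \<in> B \<Longrightarrow> x \<notin> C \<Longrightarrow>
      P (span (insert x C)) \<Longrightarrow> P C"
  shows "P A"
proof -
  have "P C" if "subspace C" "A \<subseteq> C" "C \<subseteq> B" for C
    using that
  proof (induction "dim B - dim C" arbitrary: C rule: less_induct)
    case less
    show ?case
    proof (cases "C = B")
      case True
      then show ?thesis using refl by simp
    next
      case False
      then obtain x where x: "x \<in> B" "x \<notin> C" using less.prems by auto
      have sub: "span (insert x C) \<subseteq> B"
        using less.prems x assms(2) by (intro span_minimal) auto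
      have d: "dim (span (insert x C)) = Suc (dim C)"
        using dim_span_insert less.prems x by simp
      have "P (span (insert x C))"
      proof (rule less.hyps)
        show "dim B - dim (span (insert x C)) < dim B - dim C"
          using d dim_subset[OF sub] by linarith
        show "A \<subseteq> span (insert x C)" using less.prems subset_span_insert by blast
      qed (use sub in auto)
      then show ?thesis using step less.prems x by blast
    qed
  qed
  then show ?thesis using assms by blast
qed

end

section \<open>Rank increments, flats and bases of a single q-matroid\<close>

locale finite_dim_q_matroid = finite_dimensional_vector_space scale Basis + q_matroid scale r
  for scale :: "'a::field \<Rightarrow> 'b::ab_group_add \<Rightarrow> 'b" and Basis :: "'b set" and r :: "'b set \<Rightarrow> int"
begin

lemma rank_zero [simp]: "r {0} = 0"
  using rank_bounds[of "{0}"] by simp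

text \<open>Diminishing returns: submodularity for \<open>span (insert x A)\<close> and
  \<open>B\<close>, whose sum contains \<open>x\<close> and \<open>B\<close> and whose intersection
  contains \<open>A\<close>.\<close>

lemma rank_insert_diff_antimono:
  assumes "subspace A" "subspace B" "A \<subseteq> B"
  shows "r (span (insert x B)) - r B \<le> r (span (insert x A)) - r A"
proof -
  let ?S = "span (insert x A)"
  have "x \<in> subspace_sum ?S B" "B \<subseteq> subspace_sum ?S B"
    using subset_subspace_sum[OF subspace_span \<open>subspace B\<close>, of "insert x A"] span_base[of x] by blast+
  then have "span (insert x B) \<subseteq> subspace_sum ?S B"
    using assms by (intro span_minimal subspace_sums subspace_span) auto
  then have "r (span (insert x B)) \<le> r (subspace_sum ?S B)"
    using assms by (intro rank_mono subspace_sums subspace_span)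
  moreover have "r A \<le> r (?S \<inter> B)"
    using assms span_superset by (intro rank_mono subspace_inter subspace_span) blast+
  ultimately show ?thesis
    using rank_submodular[OF subspace_span \<open>subspace B\<close>, of "insert x A"] by linarith
qed

text \<open>By diminishing returns the increment is largest over \<open>{0}\<close>, where it is the
  rank of \<open>span {x}\<close>.\<close>

lemma rank_insert_le:
  assumes "subspace A"
  shows "r (span (insert x A)) \<le> r A + 1"
proof -
  have "r (span {x}) \<le> 1"
    using rank_bounds[OF subspace_span, of "{x}"] by (simp add: dim_insert split: if_splits)
  then show ?thesis
    using rank_insert_diff_antimono[of "{0}" A x] assms subspace_0[OF assms]
    by (simp add: insert_commute[of x 0])
qed

lemma rank_diff_le_dim_diff:
  assumes "subspace A" "subspace B" "A \<subseteq> B"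
  shows "r B - r A \<le> int (dim B) - int (dim A)"
  using assms
proof (induction rule: subspace_chain_induct)
  case (insert C x)
  then show ?case using rank_insert_le[of C x] dim_span_insert[of C x] by simp
qed simp

text \<open>Replaces lines by vectors: a line not inside \<open>A\<close> contains some
  \<open>x\<close> outside \<open>A\<close>, and \<open>x\<close> outside \<open>A\<close> is
  nonzero, so it spans such a line.\<close>

lemma flat_iff_insert:
  "flat A \<longleftrightarrow> subspace A \<and> (\<forall>x. x \<notin> A \<longrightarrow> r A < r (span (insert x A)))"
proof (intro iffI conjI allI impI)
  assume f: "flat A"
  then show "subspace A" unfolding flat_def by simp
  fix x assume x: "x \<notin> A"
  then have "x \<noteq> 0" using \<open>subspace A\<close> subspace_0 by blast
  then have "dim (span {x}) = 1" by (simp add: dim_insert)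
  moreover have "\<not> span {x} \<subseteq> A" using x span_base[of x "{x}"] by blast
  ultimately have "r A < r (subspace_sum A (span {x}))"
    using f subspace_span[of "{x}"] unfolding flat_def by blast
  then show "r A < r (span (insert x A))"
    using subspace_sum_span_singleton[OF \<open>subspace A\<close>] by simp
next
  assume *: "subspace A \<and> (\<forall>x. x \<notin> A \<longrightarrow> r A < r (span (insert x A)))"
  show "flat A"
    unfolding flat_def
  proof (intro conjI allI impI)
    fix L assume L: "subspace L \<and> dim L = 1 \<and> \<not> L \<subseteq> A"
    then obtain x where x: "x \<in> L" "x \<notin> A" by auto
    have "span (insert x A) \<subseteq> subspace_sum A L"
      using subset_subspace_sum[of A L] L * x
      by (intro span_minimal subspace_sums) auto
    then have "r (span (insert x A)) \<le> r (subspace_sum A L)"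
      using L * by (intro rank_mono subspace_sums subspace_span) auto
    then show "r A < r (subspace_sum A L)" using * x by force
  qed (use * in auto)
qed

text \<open>Take \<open>F\<close> of largest dimension among the spaces above \<open>A\<close> of
  the same rank. A vector outside \<open>F\<close> that failed to raise the rank would yield a
  larger one.\<close>

lemma obtain_flat_hull:
  assumes "subspace A"
  obtains F where "flat F" "A \<subseteq> F" "r F = r A"
proof -
  let ?P = "\<lambda>F. subspace F \<and> A \<subseteq> F \<and> r F = r A"
  obtain F where F: "?P F" and max: "\<And>G. ?P G \<Longrightarrow> dim G \<le> dim F"
    using ex_has_greatest_nat[of ?P A dim "Suc (dim UNIV)"] assms dim_le_dim_UNIV
    by (auto simp: less_Suc_eq_le simp del: dim_UNIV)
  have "r F < r (span (insert x F))" if "x \<notin> F" for x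
  proof (rule ccontr)
    assume "\<not> r F < r (span (insert x F))"
    moreover have "r F \<le> r (span (insert x F))"
      using F subset_span_insert by (intro rank_mono) auto
    ultimately have "?P (span (insert x F))"
      using F span_superset[of "insert x F"] by auto
    then have "dim (span (insert x F)) \<le> dim F" by (rule max)
    then show False using dim_span_insert[of F x] F that by simp
  qed
  then show ?thesis using that F flat_iff_insert by blast
qed

lemma basis_iff_indep_spanning:
  "basis_space A \<longleftrightarrow> indep_space A \<and> spanning_space A"
proof (intro iffI conjI)
  assume b: "basis_space A"
  then show i: "indep_space A" unfolding basis_space_def by simp
  then have A: "subspace A" "r A = int (dim A)" unfolding indep_space_def by auto
  obtain F where F: "flat F" "A \<subseteq> F" "r F = r A" using obtain_flat_hull A by blast
  \<comment> \<open>A vector outside the flat hull raises the rank of \<open>F\<close>, hence that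
    of \<open>A\<close>, so adjoining it keeps \<open>A\<close> independent, against
    maximality.\<close>
  have "F = UNIV"
  proof (rule ccontr)
    assume "F \<noteq> UNIV"
    then obtain x where x: "x \<notin> F" by auto
    let ?B = "span (insert x A)"
    have "r A < r ?B"
      using rank_insert_diff_antimono[of A F x] F x A flat_iff_insert by fastforce
    moreover have "dim ?B = Suc (dim A)" using dim_span_insert A F x by blast
    ultimately have "indep_space ?B"
      using A rank_bounds[of ?B] unfolding indep_space_def by auto
    then have "?B = A" using b subset_span_insert unfolding basis_space_def by blast
    then show False using \<open>r A < r ?B\<close> by simp
  qed
  then show "spanning_space A" using F A unfolding spanning_space_def by simp
next
  assume *: "indep_space A \<and> spanning_space A"
  show "basis_space A"
    unfolding basis_space_def
  proof (intro conjI allI impI)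
    fix B assume B: "indep_space B \<and> A \<subseteq> B"
    then have "r B \<le> r UNIV" by (intro rank_mono) (auto simp: indep_space_def)
    then have "dim B \<le> dim A"
      using B * unfolding indep_space_def spanning_space_def by simp
    then show "B = A"
      using B * subspace_dim_equal[of A B] unfolding indep_space_def by auto
  qed (use * in simp)
qed

lemma ex_basis_space: "\<exists>B. basis_space B"
proof -
  have "indep_space {0}" by (simp add: indep_space_def)
  then obtain B where B: "indep_space B" and max: "\<And>C. indep_space C \<Longrightarrow> dim C \<le> dim B"
    using ex_has_greatest_nat[of indep_space "{0}" dim "Suc (dim UNIV)"] dim_le_dim_UNIV
    by (auto simp: less_Suc_eq_le simp del: dim_UNIV)
  then have "basis_space B"
    unfolding basis_space_def by (metis indep_space_def subspace_dim_equal)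
  then show ?thesis ..
qed

lemma dim_basis_space: "basis_space B \<Longrightarrow> int (dim B) = r UNIV"
  by (auto simp: basis_iff_indep_spanning indep_space_def spanning_space_def)

end

section \<open>Strong maps as a rank inequality\<close>

context finite_dimensional_vector_space
begin

lemma id_strong_map_iff_rank_diff:
  assumes q1: "q_matroid scale r1" and q2: "q_matroid scale r2"
  shows "id_strong_map scale r1 r2 \<longleftrightarrow>
    (\<forall>A B. subspace A \<longrightarrow> subspace B \<longrightarrow> A \<subseteq> B \<longrightarrow> r2 B - r2 A \<le> r1 B - r1 A)"
proof -
  interpret M1: q_matroid scale r1 by fact
  interpret M1: finite_dim_q_matroid scale Basis r1 ..
  interpret M2: q_matroid scale r2 by fact
  interpret M2: finite_dim_q_matroid scale Basis r2 ..
  show ?thesis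
    unfolding id_strong_map_def
  proof (intro iffI allI impI)
    fix A B
    assume strong: "\<forall>A. M2.flat A \<longrightarrow> M1.flat A"
    assume "subspace A" "subspace B" "A \<subseteq> B"
    then show "r2 B - r2 A \<le> r1 B - r1 A"
    proof (induction rule: subspace_chain_induct)
      case (insert C x)
      have "r2 (span (insert x C)) - r2 C \<le> r1 (span (insert x C)) - r1 C"
      \<comment> \<open>A single vector raises \<open>r2\<close> by at most 1, so it is enough that
        \<open>r1\<close> grows strictly whenever \<open>r2\<close> does.\<close>
      proof (cases "r2 (span (insert x C)) \<le> r2 C")
        case True
        have "r1 C \<le> r1 (span (insert x C))"
          using insert subset_span_insert by (intro M1.rank_mono) auto
        then show ?thesis using True by simp
      next
        case False
        obtain F where F: "M2.flat F" "C \<subseteq> F" "r2 F = r2 C"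
          using M2.obtain_flat_hull insert by blast
        have F_sub: "subspace F" using F M2.flat_def by blast
        have "x \<notin> F"
        proof
          assume "x \<in> F"
          then have "span (insert x C) \<subseteq> F"
            using F F_sub by (intro span_minimal) auto
          then have "r2 (span (insert x C)) \<le> r2 F"
            using F_sub by (intro M2.rank_mono) auto
          then show False using F False by simp
        qed
        then have "r1 F < r1 (span (insert x F))"
          using strong F M1.flat_iff_insert by blast
        then have "r1 C < r1 (span (insert x C))"
          using M1.rank_insert_diff_antimono[of C F x] F F_sub insert by simp
        then show ?thesis using M2.rank_insert_le[of C x] insert by simp
      qed
      then show ?case using insert.IH by simp
    qed simp
  next
    fix A
    assume diff: "\<forall>A B. subspace A \<longrightarrow> subspace B \<longrightarrow> A \<subseteq> B \<longrightarrow> r2 B - r2 A \<le> r1 B - r1 A"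
    assume f: "M2.flat A"
    have "r1 A < r1 (span (insert x A))" if "x \<notin> A" for x
      using diff[rule_format, of A "span (insert x A)"] f that span_superset[of "insert x A"]
      unfolding M2.flat_iff_insert by fastforce
    then show "M1.flat A" using f by (simp add: M1.flat_iff_insert M2.flat_iff_insert)
  qed
qed

section \<open>Families of bases, independent spaces and spanning spaces\<close>

lemma q_matroid_free: "q_matroid scale (\<lambda>A. int (dim A))"
proof unfold_locales
  fix A B assume "subspace A" "subspace B"
  then show "int (dim (subspace_sum A B)) + int (dim (A \<inter> B)) \<le> int (dim A) + int (dim B)"
    using dim_sums_Int[of A B] by simp
qed (auto intro: dim_subset)

lemma q_matroid_trivial: "q_matroid scale (\<lambda>A. 0)"
  by unfold_locales auto

lemma q_g_matroidI:
  assumes "q_matroid scale r1" "q_matroid scale r2"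
    and "\<And>A B. subspace A \<Longrightarrow> subspace B \<Longrightarrow> A \<subseteq> B \<Longrightarrow> r2 B - r2 A \<le> r1 B - r1 A"
    and "\<F> = {A. q_matroid.indep_space scale r1 A \<and> q_matroid.spanning_space scale r2 A}"
  shows "q_g_matroid scale \<F>"
proof -
  have "id_strong_map scale r1 r2"
    by (rule iffD2[OF id_strong_map_iff_rank_diff[OF assms(1,2)]]) (intro allI impI assms(3))
  then show ?thesis unfolding q_g_matroid_def using assms(1,2,4) by blast
qed

lemma q_g_matroid_bases:
  assumes "q_matroid scale r"
  shows "q_g_matroid scale {A. q_matroid.basis_space scale r A}"
proof -
  interpret q_matroid scale r by fact
  interpret finite_dim_q_matroid scale Basis r ..
  show ?thesis
    \<comment> \<open>Both q-matroids are the given one, and the rank inequality is an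
      equality.\<close>
    using assms by (intro q_g_matroidI) (auto simp: basis_iff_indep_spanning)
qed

lemma q_g_matroid_indeps:
  assumes "q_matroid scale r"
  shows "q_g_matroid scale {A. q_matroid.indep_space scale r A}"
proof -
  interpret q_matroid scale r by fact
  interpret T: q_matroid scale "\<lambda>A. 0" by (rule q_matroid_trivial)
  \<comment> \<open>With \<open>r2\<close> zero every subspace is spanning, and the rank inequality
    is monotonicity of \<open>r\<close>.\<close>
  show ?thesis
    using assms q_matroid_trivial
    by (rule q_g_matroidI) (auto simp: T.spanning_space_def indep_space_def rank_mono)
qed

lemma q_g_matroid_spannings:
  assumes "q_matroid scale r"
  shows "q_g_matroid scale {A. q_matroid.spanning_space scale r A}"
proof -
  interpret q_matroid scale r by fact
  interpret finite_dim_q_matroid scale Basis r ..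
  interpret D: q_matroid scale "\<lambda>A. int (dim A)" by (rule q_matroid_free)
  \<comment> \<open>With \<open>r1\<close> the dimension every subspace is independent, and the rank
    inequality says that rank grows no faster than dimension.\<close>
  show ?thesis
    using q_matroid_free assms
    by (rule q_g_matroidI)
      (auto simp: D.indep_space_def spanning_space_def intro: rank_diff_le_dim_diff)
qed

section \<open>Members of extremal dimension\<close>

lemma bases_of_q_matroid_extremal_members:
  assumes "q_g_matroid scale \<F>"
  shows "bases_of_q_matroid scale (max_dim_members scale \<F>)"
    and "bases_of_q_matroid scale (min_dim_members scale \<F>)"
proof -
  obtain r1 r2 where q: "q_matroid scale r1" "q_matroid scale r2"
    and strong: "id_strong_map scale r1 r2"
    and \<F>: "\<F> = {A. q_matroid.indep_space scale r1 A \<and> q_matroid.spanning_space scale r2 A}"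
    using assms unfolding q_g_matroid_def by blast
  note diff = iffD1[OF id_strong_map_iff_rank_diff[OF q] strong, rule_format]
  interpret M1: q_matroid scale r1 by fact
  interpret M1: finite_dim_q_matroid scale Basis r1 ..
  interpret M2: q_matroid scale r2 by fact
  interpret M2: finite_dim_q_matroid scale Basis r2 ..
  \<comment> \<open>Between \<open>A\<close> and \<open>UNIV\<close> the rank \<open>r1\<close> does
    not grow, so neither does \<open>r2\<close>.\<close>
  have basis1: "A \<in> \<F>" if "M1.basis_space A" for A
  proof -
    have A: "M1.indep_space A" "M1.spanning_space A"
      using that M1.basis_iff_indep_spanning by auto
    then have "subspace A" "r2 UNIV \<le> r2 A"
      using diff[of A UNIV] by (auto simp: M1.spanning_space_def)
    moreover from this have "r2 A \<le> r2 UNIV" by (intro M2.rank_mono) auto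
    ultimately show ?thesis using A by (auto simp: \<F> M2.spanning_space_def)
  qed
  \<comment> \<open>Both ranks vanish at \<open>{0}\<close>, so the inequality between
    \<open>{0}\<close> and \<open>A\<close> gives \<open>r2 A \<le> r1 A\<close>.\<close>
  have basis2: "A \<in> \<F>" if "M2.basis_space A" for A
  proof -
    have A: "subspace A" "r2 A = int (dim A)" "M2.spanning_space A"
      using that M2.basis_iff_indep_spanning by (auto simp: M2.indep_space_def)
    then have "int (dim A) \<le> r1 A"
      using diff[of "{0}" A] subspace_0[of A] by simp
    then show ?thesis
      using A M1.rank_bounds[of A] by (auto simp: \<F> M1.indep_space_def)
  qed
  \<comment> \<open>A member satisfies \<open>dim A = r1 A\<close> and
    \<open>r2 A = r2 UNIV\<close>, so its dimension lies between \<open>r2 UNIV\<close> and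
    \<open>r1 UNIV\<close>. At either end it is both independent and spanning in the corresponding
    q-matroid.\<close>
  have dim_le: "int (dim A) \<le> r1 UNIV" "dim A = r1 UNIV \<Longrightarrow> M1.basis_space A" if "A \<in> \<F>" for A
    using that M1.rank_mono[of A UNIV]
    by (auto simp: \<F> M1.indep_space_def M1.spanning_space_def M1.basis_iff_indep_spanning)
  have dim_ge: "r2 UNIV \<le> int (dim A)" "dim A = r2 UNIV \<Longrightarrow> M2.basis_space A" if "A \<in> \<F>" for A
    using that M2.rank_bounds[of A]
    by (auto simp: \<F> M2.indep_space_def M2.spanning_space_def M2.basis_iff_indep_spanning)
  \<comment> \<open>These witness that both bounds are attained in the family, so extremal members
    must meet them.\<close>
  obtain B1 B2 where B: "M1.basis_space B1" "M2.basis_space B2"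
    using M1.ex_basis_space M2.ex_basis_space by blast
  have "max_dim_members scale \<F> = {A. M1.basis_space A}"
  proof (intro equalityI subsetI CollectI)
    fix A assume A: "A \<in> max_dim_members scale \<F>"
    then have "A \<in> \<F>" "dim B1 \<le> dim A"
      using basis1[OF B(1)] by (auto simp: max_dim_members_def)
    then show "M1.basis_space A"
      using dim_le[of A] M1.dim_basis_space[OF B(1)] by linarith
  next
    fix A assume "A \<in> {A. M1.basis_space A}"
    then show "A \<in> max_dim_members scale \<F>"
      using basis1 dim_le M1.dim_basis_space by (force simp: max_dim_members_def)
  qed
  then show "bases_of_q_matroid scale (max_dim_members scale \<F>)"
    using q unfolding bases_of_q_matroid_def by blast
  have "min_dim_members scale \<F> = {A. M2.basis_space A}"
  proof (intro equalityI subsetI CollectI)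
    fix A assume A: "A \<in> min_dim_members scale \<F>"
    then have "A \<in> \<F>" "dim A \<le> dim B2"
      using basis2[OF B(2)] by (auto simp: min_dim_members_def)
    then show "M2.basis_space A"
      using dim_ge[of A] M2.dim_basis_space[OF B(2)] by linarith
  next
    fix A assume "A \<in> {A. M2.basis_space A}"
    then show "A \<in> min_dim_members scale \<F>"
      using basis2 dim_ge M2.dim_basis_space by (force simp: min_dim_members_def)
  qed
  then show "bases_of_q_matroid scale (min_dim_members scale \<F>)"
    using q unfolding bases_of_q_matroid_def by blast
qed

section \<open>Orthogonal complements for a nondegenerate form\<close>

lemma nondegenerate_bilinear_form_swap:
  "nondegenerate_bilinear_form scale \<beta> \<Longrightarrow> nondegenerate_bilinear_form scale (\<lambda>x y. \<beta> y x)"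
  unfolding nondegenerate_bilinear_form_def by auto

lemma orth_compl_antimono: "A \<subseteq> B \<Longrightarrow> orth_compl \<beta> B \<subseteq> orth_compl \<beta> A"
  unfolding orth_compl_def by auto

end

locale nondegenerate_form_space = finite_dimensional_vector_space scale Basis
  for scale :: "'a::field \<Rightarrow> 'b::ab_group_add \<Rightarrow> 'b" and Basis :: "'b set" +
  fixes \<beta> :: "'b \<Rightarrow> 'b \<Rightarrow> 'a"
  assumes nondegenerate: "nondegenerate_bilinear_form scale \<beta>"
begin

text \<open>Right and left complement. They may differ when the form is not symmetric, but on
  subspaces they turn out to be mutually inverse.\<close>

abbreviation orth where "orth \<equiv> orth_compl \<beta>"
abbreviation orth' where "orth' \<equiv> orth_compl (\<lambda>x y. \<beta> y x)"

lemma form_right: "\<beta> x (y + z) = \<beta> x y + \<beta> x z" "\<beta> x (scale c y) = c * \<beta> x y"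
  and form_left: "\<beta> (y + z) x = \<beta> y x + \<beta> z x" "\<beta> (scale c y) x = c * \<beta> y x"
proof -
  interpret R: Vector_Spaces.linear scale "(*)" "\<beta> x" for x
    using nondegenerate unfolding nondegenerate_bilinear_form_def by blast
  interpret L: Vector_Spaces.linear scale "(*)" "\<lambda>x. \<beta> x y" for y
    using nondegenerate unfolding nondegenerate_bilinear_form_def by blast
  show "\<beta> x (y + z) = \<beta> x y + \<beta> x z" "\<beta> x (scale c y) = c * \<beta> x y"
    "\<beta> (y + z) x = \<beta> y x + \<beta> z x" "\<beta> (scale c y) x = c * \<beta> y x"
    by (rule R.add R.scale L.add L.scale)+
qed

lemma form_zero_right [simp]: "\<beta> x 0 = 0"
  using form_right(2)[of x 0 0] by simp

lemma form_zero_left [simp]: "\<beta> 0 x = 0"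
  using form_left(2)[of 0 0 x] by simp

lemma subspace_orth [simp]: "subspace (orth A)"
  by (rule subspaceI) (auto simp: orth_compl_def form_right)

lemma orth_zero [simp]: "orth {0} = UNIV"
  by (simp add: orth_compl_def)

lemma orth_UNIV [simp]: "orth UNIV = {0}"
  using nondegenerate by (auto simp: orth_compl_def nondegenerate_bilinear_form_def)

text \<open>For fixed \<open>v\<close> the vectors \<open>w\<close> with
  \<open>\<beta> w v = 0\<close> form a subspace, so orthogonality can be tested on
  generators.\<close>

lemma orth_span_insert: "orth (span (insert x A)) = orth A \<inter> {v. \<beta> x v = 0}"
proof -
  have "subspace {w. \<beta> w v = 0}" for v
    by (rule subspaceI) (auto simp: form_left)
  then have "\<beta> w v = 0" if "v \<in> orth A" "\<beta> x v = 0" "w \<in> span (insert x A)" for v w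
    using span_minimal[of "insert x A" "{w. \<beta> w v = 0}"] that
    by (auto simp: orth_compl_def)
  then show ?thesis
    using span_superset[of "insert x A"] by (auto simp: orth_compl_def)
qed

text \<open>The kernel of one linear functional has codimension at most 1 in \<open>U\<close>: any
  \<open>u\<close> in \<open>U\<close> outside the kernel spans \<open>U\<close> together with the
  kernel part.\<close>

lemma dim_Int_hyperplane:
  assumes "subspace U"
  shows "dim U \<le> Suc (dim (U \<inter> {v. \<beta> x v = 0}))"
proof (cases "U \<subseteq> {v. \<beta> x v = 0}")
  case True
  then show ?thesis by (simp add: Int_absorb2)
next
  case False
  then obtain u where u: "u \<in> U" "\<beta> x u \<noteq> 0" by auto
  have "v \<in> span (insert u (U \<inter> {v. \<beta> x v = 0}))" if "v \<in> U" for v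
  proof -
    \<comment> \<open>Chosen so that \<open>v - scale c u\<close> lies in the kernel; the next
      equation is additive because \<open>form_right\<close> treats sums and multiples only.\<close>
    define c where "c = \<beta> x v / \<beta> x u"
    have "\<beta> x (v - scale c u) + \<beta> x (scale c u) = \<beta> x v"
      by (simp flip: form_right(1))
    then have "v - scale c u \<in> U \<inter> {v. \<beta> x v = 0}"
      using u that assms by (auto simp: c_def form_right subspace_diff subspace_scale)
    then show ?thesis unfolding span_breakdown_eq by (intro exI span_base)
  qed
  then have "dim U \<le> dim (span (insert u (U \<inter> {v. \<beta> x v = 0})))"
    by (intro dim_subset subsetI)
  also have "\<dots> \<le> Suc (dim (U \<inter> {v. \<beta> x v = 0}))"
    by (simp add: dim_insert)
  finally show ?thesis .
qed

text \<open>Each new vector adds one dimension to \<open>C\<close> and cuts at most one from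
  \<open>orth C\<close>.\<close>

lemma dim_orth_diff_le:
  assumes "subspace A" "subspace B" "A \<subseteq> B"
  shows "dim (orth A) + dim A \<le> dim (orth B) + dim B"
  using assms
proof (induction rule: subspace_chain_induct)
  case (insert C x)
  have "dim (orth C) \<le> Suc (dim (orth (span (insert x C))))"
    unfolding orth_span_insert by (rule dim_Int_hyperplane) simp
  then show ?case using insert dim_span_insert[of C x] by simp
qed simp

text \<open>The sum on the left is monotone in \<open>A\<close> by \<open>dim_orth_diff_le\<close>
  and equals \<open>dim UNIV\<close> at both \<open>{0}\<close> and \<open>UNIV\<close>, hence is
  constant.\<close>

lemma dim_orth:
  assumes "subspace A"
  shows "dim (orth A) + dim A = dim UNIV"
proof (rule antisym)
  show "dim (orth A) + dim A \<le> dim UNIV"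
    using dim_orth_diff_le[OF assms subspace_UNIV subset_UNIV] by simp
  have "dim (orth {0}) + dim {0} \<le> dim (orth A) + dim A"
    using assms subspace_0[OF assms] by (intro dim_orth_diff_le) auto
  then show "dim UNIV \<le> dim (orth A) + dim A" by simp
qed

text \<open>Transfers every fact about \<open>orth\<close> to \<open>orth'\<close>.\<close>

lemma swap:
  "nondegenerate_form_space scale Basis (\<lambda>x y. \<beta> y x)"
  by unfold_locales (rule nondegenerate_bilinear_form_swap[OF nondegenerate])

lemma subspace_orth' [simp]: "subspace (orth' A)"
  by (rule nondegenerate_form_space.subspace_orth[OF swap])

text \<open>One inclusion is immediate, and \<open>dim_orth\<close> for the form and its swap makes
  the dimensions equal.\<close>

lemma orth'_orth [simp]:
  assumes "subspace A"
  shows "orth' (orth A) = A"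
proof -
  have "A \<subseteq> orth' (orth A)" by (auto simp: orth_compl_def)
  moreover have "dim (orth' (orth A)) + dim (orth A) = dim (orth A) + dim A"
    using dim_orth[OF assms] nondegenerate_form_space.dim_orth[OF swap, of "orth A"] by simp
  ultimately show ?thesis
    using assms subspace_dim_equal[of A "orth' (orth A)"] by simp
qed

lemma orth_orth' [simp]: "subspace A \<Longrightarrow> orth (orth' A) = A"
  by (rule nondegenerate_form_space.orth'_orth[OF swap])

lemma orth_sum:
  assumes "subspace A" "subspace B"
  shows "orth (subspace_sum A B) = orth A \<inter> orth B"
proof
  show "orth (subspace_sum A B) \<subseteq> orth A \<inter> orth B"
    using subset_subspace_sum[OF assms] orth_compl_antimono by blast
qed (auto simp: orth_compl_def form_left)

text \<open>Obtained from \<open>orth_sum\<close> for the swapped form by taking complements on both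
  sides.\<close>

lemma orth_Int:
  assumes "subspace A" "subspace B"
  shows "orth (A \<inter> B) = subspace_sum (orth A) (orth B)"
proof -
  have "orth' (subspace_sum (orth A) (orth B)) = A \<inter> B"
    using assms nondegenerate_form_space.orth_sum[OF swap, of "orth A" "orth B"] by simp
  then show ?thesis
    using orth_orth'[OF subspace_sums[of "orth A" "orth B"]] by simp
qed

section \<open>Duality\<close>

text \<open>The rank formula of the dual matroid, with the orthogonal complement in place of the set
  complement.\<close>

definition dual_rank :: "('b set \<Rightarrow> int) \<Rightarrow> 'b set \<Rightarrow> int" where
  "dual_rank r A = int (dim A) - r UNIV + r (orth A)"

lemma dim_orth_int: "subspace A \<Longrightarrow> int (dim (orth A)) = int (dim UNIV) - int (dim A)"
  using dim_orth[of A] by linarith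

text \<open>Monotonicity and unit increase of \<open>r\<close> trade places under complements.
  Submodularity survives because \<open>orth\<close> exchanges sums and intersections while
  dimension is modular.\<close>

lemma q_matroid_dual:
  assumes "q_matroid scale r"
  shows "q_matroid scale (dual_rank r)"
proof -
  interpret q_matroid scale r by fact
  interpret finite_dim_q_matroid scale Basis r ..
  show ?thesis
  proof unfold_locales
    fix A assume A: "subspace A"
    have "r UNIV - r (orth A) \<le> int (dim UNIV) - int (dim (orth A))"
      by (rule rank_diff_le_dim_diff) simp_all
    moreover have "r (orth A) \<le> r UNIV"
      by (rule rank_mono) simp_all
    ultimately show "0 \<le> dual_rank r A \<and> dual_rank r A \<le> int (dim A)"
      using dim_orth_int[OF A] unfolding dual_rank_def by linarith
    fix B assume B: "subspace B"
    show "dual_rank r A \<le> dual_rank r B" if "A \<subseteq> B"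
    proof -
      have "r (orth A) - r (orth B) \<le> int (dim (orth A)) - int (dim (orth B))"
        using orth_compl_antimono[OF that] by (intro rank_diff_le_dim_diff) simp_all
      then show ?thesis
        using dim_orth_int[OF A] dim_orth_int[OF B] unfolding dual_rank_def by linarith
    qed
    show "dual_rank r (subspace_sum A B) + dual_rank r (A \<inter> B) \<le> dual_rank r A + dual_rank r B"
      using rank_submodular[OF subspace_orth subspace_orth, of A B] dim_sums_Int[OF A B]
      unfolding dual_rank_def orth_sum[OF A B] orth_Int[OF A B] by linarith
  qed
qed

lemma dual_indep_iff:
  assumes "q_matroid scale r"
  shows "q_matroid.indep_space scale (dual_rank r) A \<longleftrightarrow>
    subspace A \<and> q_matroid.spanning_space scale r (orth A)"
proof -
  interpret q_matroid scale r by fact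
  interpret D: q_matroid scale "dual_rank r" by (rule q_matroid_dual) fact
  show ?thesis
    by (auto simp: D.indep_space_def spanning_space_def dual_rank_def)
qed

text \<open>Since \<open>orth UNIV\<close> is \<open>{0}\<close>, the full dual rank is
  \<open>dim UNIV - r UNIV\<close>. Attaining it at \<open>A\<close> means that
  \<open>r (orth A)\<close> equals \<open>dim UNIV - dim A\<close>, the dimension of
  \<open>orth A\<close>.\<close>

lemma dual_spanning_iff:
  assumes "q_matroid scale r"
  shows "q_matroid.spanning_space scale (dual_rank r) A \<longleftrightarrow>
    subspace A \<and> q_matroid.indep_space scale r (orth A)"
proof -
  interpret q_matroid scale r by fact
  interpret finite_dim_q_matroid scale Basis r ..
  interpret D: q_matroid scale "dual_rank r" by (rule q_matroid_dual) fact
  show ?thesis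
    using dim_orth_int[of A]
    by (auto simp: D.spanning_space_def indep_space_def dual_rank_def)
qed

text \<open>The form need not be symmetric: the rank of the dual is measured on \<open>orth A\<close>, whereas the
  members are mapped by \<open>orth'\<close>, its inverse.\<close>

lemma q_g_matroid_dual:
  assumes "q_g_matroid scale \<F>"
  shows "q_g_matroid scale (orth' ` \<F>)"
proof -
  obtain r1 r2 where q: "q_matroid scale r1" "q_matroid scale r2"
    and strong: "id_strong_map scale r1 r2"
    and \<F>: "\<F> = {A. q_matroid.indep_space scale r1 A \<and> q_matroid.spanning_space scale r2 A}"
    using assms unfolding q_g_matroid_def by blast
  note diff = iffD1[OF id_strong_map_iff_rank_diff[OF q] strong, rule_format]
  show ?thesis
  proof (rule q_g_matroidI)
    \<comment> \<open>Duality reverses the strong map: the dual of the second q-matroid comes first.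
      In the rank inequality the dimensions cancel and \<open>orth\<close> reverses the
      inclusion.\<close>
    show "q_matroid scale (dual_rank r2)" "q_matroid scale (dual_rank r1)"
      using q q_matroid_dual by blast+
    show "dual_rank r1 B - dual_rank r1 A \<le> dual_rank r2 B - dual_rank r2 A"
      if "A \<subseteq> B" for A B
      using diff[of "orth B" "orth A"] orth_compl_antimono[OF that, of \<beta>]
      by (simp add: dual_rank_def)
    have sub: "subspace A" if "A \<in> \<F>" for A
      using that q_matroid.indep_space_def[OF q(1)] by (simp add: \<F>)
    \<comment> \<open>As \<open>orth\<close> inverts \<open>orth'\<close>, the image becomes a
      preimage under \<open>orth\<close>, the form in which the two dual characterizations
      apply.\<close>
    have "orth' ` \<F> = {A. subspace A \<and> orth A \<in> \<F>}"
    proof (intro equalityI subsetI)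
      fix A assume "A \<in> {A. subspace A \<and> orth A \<in> \<F>}"
      then show "A \<in> orth' ` \<F>" by (auto intro!: image_eqI[of _ _ "orth A"])
    qed (use sub in auto)
    then show "orth' ` \<F> = {A. q_matroid.indep_space scale (dual_rank r2) A \<and>
        q_matroid.spanning_space scale (dual_rank r1) A}"
      using dual_indep_iff[OF q(2)] dual_spanning_iff[OF q(1)] by (auto simp: \<F>)
  qed
qed

end

theorem proposition4p5:
  fixes scale :: "'a::field \<Rightarrow> 'b::ab_group_add \<Rightarrow> 'b"
    and Basis :: "'b set"
    and \<beta> :: "'b \<Rightarrow> 'b \<Rightarrow> 'a"
  assumes "finite_dimensional_vector_space scale Basis"
    and "nondegenerate_bilinear_form scale \<beta>"
  shows "(\<forall>\<B>. bases_of_q_matroid scale \<B> \<longrightarrow> q_g_matroid scale \<B>) \<and>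
    (\<forall>\<I>. indeps_of_q_matroid scale \<I> \<longrightarrow> q_g_matroid scale \<I>) \<and>
    (\<forall>\<S>. spannings_of_q_matroid scale \<S> \<longrightarrow> q_g_matroid scale \<S>) \<and>
    (\<forall>\<F>. q_g_matroid scale \<F> \<longrightarrow>
      bases_of_q_matroid scale (max_dim_members scale \<F>) \<and>
      bases_of_q_matroid scale (min_dim_members scale \<F>)) \<and>
    (\<forall>\<F>. q_g_matroid scale \<F> \<longrightarrow> q_g_matroid scale (orth_compl \<beta> ` \<F>))"
proof -
  interpret finite_dimensional_vector_space scale Basis by fact
  \<comment> \<open>With the arguments swapped, \<open>orth'\<close> of the locale is the complement
    \<open>orth_compl \<beta>\<close> of the claim.\<close>
  interpret nondegenerate_form_space scale Basis "\<lambda>x y. \<beta> y x"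
    by unfold_locales (rule nondegenerate_bilinear_form_swap, fact)
  show ?thesis
  proof (intro conjI allI impI)
    fix \<F> assume "q_g_matroid scale \<F>"
    then show "bases_of_q_matroid scale (max_dim_members scale \<F>)"
      "bases_of_q_matroid scale (min_dim_members scale \<F>)"
      "q_g_matroid scale (orth_compl \<beta> ` \<F>)"
      by (rule bases_of_q_matroid_extremal_members q_g_matroid_dual)+
  qed (auto simp: bases_of_q_matroid_def indeps_of_q_matroid_def spannings_of_q_matroid_def
      intro: q_g_matroid_bases q_g_matroid_indeps q_g_matroid_spannings)
qed

end
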